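(* Let $U=\mathcal W(0,1,p,q)$, $T=\mathcal W(1,0,p,q)$, and $x_n=U_n/U_{n-1}$ for $n\geq 2$. Choose a sequence $g=\mathcal W(i,j,s,t)$ for some $i,j\geq 2$. Then for every $n\geq 2$ $$U_{g_n}=a_2U^{(s)}_{g_{n-1}}T^{(-t)}_{g_{n-2}}+b_2T^{(s)}_{g_{n-1}}U^{(-t)}_{g_{n-2}}+(a_1b_2+a_2b_4)U^{(s)}_{g_{n-1}}U^{(-t)}_{g_{n-2}},$$ $$T_{g_n}=T^{(s)}_{g_{n-1}}T^{(-t)}_{g_{n-2}}+a_1U^{(s)}_{g_{n-1}}T^{(-t)}_{g_{n-2}}+b_1T^{(s)}_{g_{n-1}}U^{(-t)}_{g_{n-2}}+(a_1b_1+a_2b_3)U^{(s)}_{g_{n-1}}U^{(-t)}_{g_{n-2}},$$ where $U^{(s)}=\mathcal W(0,1,V_s,q^s)$, $T^{(s)}=\mathcal W(1,0,V_s,q^s)$ (and similarly with $-t$ in place of $s$), and $$M^s=\begin{pmatrix} a_1 & a_2 \cr a_3 & a_4\end{pmatrix},\qquad M^{-t}=\begin{pmatrix} b_1 & b_2 \cr b_3 & b_4\end{pmatrix}.$$ Moreover, taking $x_i$ and $x_j$ as the initial steps of the acceleration of $x$, for all $n\geq 2$ $$x_{g_n}=\cfrac{q^2a_2x_{g_{n-1}}^{(s)}+q^2b_2x_{g_{n-2}}^{(-t)}-q(a_1b_2+a_2b_4)x_{g_{n-1}}^{(s)}x_{g_{n-2}}^{(-t)}}{q^2-qa_1x_{g_{n-1}}^{(s)}-qb_1x_{g_{n-2}}^{(-t)}+(a_1b_1+a_2b_3)x_{g_{n-1}}^{(s)}x_{g_{n-2}}^{(-t)}},$$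 where $x^{(s)}=-q\,U^{(s)}/T^{(s)}$ (and similarly $x^{(-t)}=-q\,U^{(-t)}/T^{(-t)}$).
   Context: Let $R$ be an integral domain with unit. For $\alpha,\beta,p,q\in R$, $\mathcal W(\alpha,\beta,p,q)$ denotes the linear recurrent sequence $(a_n)_{n\ge0}$ with $a_0=\alpha$, $a_1=\beta$, $a_n=pa_{n-1}-qa_{n-2}$ for $n\geq2$. $V=\mathcal W(2,p,p,q)$ is the Lucas sequence with parameters $p,q$, and $M=\begin{pmatrix} 0 & 1 \cr -q & p\end{pmatrix}$ is the companion matrix, so that $M^n=\begin{pmatrix} T_n & U_n \cr T_{n+1} & U_{n+1}\end{pmatrix}$. *)

theory Defs
  imports "HOL-Analysis.Analysis" "HOL-Computational_Algebra.Polynomial_Factorial"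
begin

fun lin_rec :: "'a::comm_ring_1 \<Rightarrow> 'a \<Rightarrow> 'a \<Rightarrow> 'a \<Rightarrow> nat \<Rightarrow> 'a" where
  "lin_rec \<alpha> \<beta> p q 0 = \<alpha>"
| "lin_rec \<alpha> \<beta> p q (Suc 0) = \<beta>"
| "lin_rec \<alpha> \<beta> p q (Suc (Suc n)) = p * lin_rec \<alpha> \<beta> p q (Suc n) - q * lin_rec \<alpha> \<beta> p q n"

text \<open>
  The two-sided extension of the sequence, obtained for negative indices by running the recurrence
  backwards, \<open>a\<^sub>k = (p a\<^bsub>k+1\<^esub> - a\<^bsub>k+2\<^esub>) / q\<close>. Read from the index 0 downwards, this is again a
  linear recurrent sequence: it starts with \<open>\<alpha>\<close>, \<open>(p \<alpha> - \<beta>) / q\<close> and has parameters \<open>p / q\<close>, \<open>1 / q\<close>.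
  The values at negative indices are meaningful only for \<open>q \<noteq> 0\<close>.
\<close>

definition lin_rec_int :: "'a::field \<Rightarrow> 'a \<Rightarrow> 'a \<Rightarrow> 'a \<Rightarrow> int \<Rightarrow> 'a" where
  "lin_rec_int \<alpha> \<beta> p q k =
     (if k \<ge> 0 then lin_rec \<alpha> \<beta> p q (nat k)
      else lin_rec \<alpha> ((p * \<alpha> - \<beta>) / q) (p / q) (1 / q) (nat (- k)))"

lemma lin_rec_int_of_nat:
  "lin_rec_int (to_fract \<alpha>) (to_fract \<beta>) (to_fract p) (to_fract q) (int n)
     = to_fract (lin_rec \<alpha> \<beta> p q n)"
proof -
  have "lin_rec (to_fract \<alpha>) (to_fract \<beta>) (to_fract p) (to_fract q) n
      = to_fract (lin_rec \<alpha> \<beta> p q n)"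
    by (induction \<alpha> \<beta> p q n rule: lin_rec.induct) simp_all
  then show ?thesis
    by (simp add: lin_rec_int_def)
qed

lemma lin_rec_int_rec:
  assumes "q \<noteq> 0"
  shows "lin_rec_int \<alpha> \<beta> p q (k + 2)
           = p * lin_rec_int \<alpha> \<beta> p q (k + 1) - q * lin_rec_int \<alpha> \<beta> p q k"
proof -
  consider "k \<ge> 0" | "k = -1" | "k \<le> -2" by linarith
  then show ?thesis
  proof cases
    case 1
    then obtain n where "k = int n" by (metis nonneg_int_cases)
    then show ?thesis by (simp add: lin_rec_int_def nat_add_distrib)
  next
    case 2
    then show ?thesis using assms by (simp add: lin_rec_int_def)
  next
    case 3
    define n where "n = nat (- k - 2)"
    have k: "k = - int n - 2" using 3 by (simp add: n_def)
    have 0: "nat (- k) = Suc (Suc n)" "nat (- (k + 1)) = Suc n" "nat (- (k + 2)) = n"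
      by (auto simp: k)
    have "lin_rec_int \<alpha> \<beta> p q (k + 2) = lin_rec \<alpha> ((p * \<alpha> - \<beta>) / q) (p / q) (1 / q) n"
      using 0 by (cases n) (auto simp: lin_rec_int_def k)
    moreover have "lin_rec_int \<alpha> \<beta> p q (k + 1) = lin_rec \<alpha> ((p * \<alpha> - \<beta>) / q) (p / q) (1 / q) (Suc n)"
      using 0 3 by (simp only: lin_rec_int_def if_False) auto
    moreover have "lin_rec_int \<alpha> \<beta> p q k = lin_rec \<alpha> ((p * \<alpha> - \<beta>) / q) (p / q) (1 / q) (Suc (Suc n))"
      using 0 3 by (simp only: lin_rec_int_def if_False) auto
    ultimately show ?thesis using assms by (simp add: field_simps)
  qed
qed

text \<open>
  Integer powers with respect to the matrix product; the class operations \<open>*\<close> and \<open>^\<close> on vectors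
  are componentwise. Negative powers are meaningful only for invertible matrices.
\<close>

definition matrix_powi :: "'a::field^'n^'n \<Rightarrow> int \<Rightarrow> 'a^'n^'n" where
  "matrix_powi A k =
     (if k \<ge> 0 then (((**) A) ^^ nat k) (mat 1)
      else (((**) (matrix_inv A)) ^^ nat (- k)) (mat 1))"

definition companion :: "'a::field \<Rightarrow> 'a \<Rightarrow> 'a^2^2" where
  "companion p q = vector [vector [0, 1], vector [- q, p]]"

end

theory Submission
  imports Defs
begin

text \<open>
  Powers of the companion matrix encode the addition law
  \<open>f\<^bsub>m+n\<^esub> = T\<^sub>m f\<^sub>n + U\<^sub>m f\<^bsub>n+1\<^esub>\<close> for every solution \<open>f\<close> of the recurrence. By
  Cayley--Hamilton for the \<open>r\<close>-th power of the matrix, whose trace is \<open>V\<^sub>r\<close> and whose determinant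
  is \<open>q\<^sup>r\<close>, the subsequence of \<open>f\<close> along an arithmetic progression with step \<open>r\<close> solves the
  recurrence with parameters \<open>V\<^sub>r\<close>, \<open>q\<^sup>r\<close>. Writing \<open>g\<^sub>n = s g\<^bsub>n-1\<^esub> + (-t) g\<^bsub>n-2\<^esub>\<close> and combining
  the two facts gives the formulas for \<open>U\<close> and \<open>T\<close>; dividing them and using \<open>T\<^sub>k = -q U\<^bsub>k-1\<^esub>\<close>
  gives the formula for \<open>x\<close>. For \<open>q = 0\<close> the indices \<open>s\<close>, \<open>-t\<close> and \<open>g\<^sub>n\<close> are nonnegative.
\<close>

section \<open>Solutions of the recurrence over the integers and their addition law\<close>

lemma lin_rec_int_0 [simp]: "lin_rec_int \<alpha> \<beta> p q 0 = \<alpha>"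
  by (simp add: lin_rec_int_def)

lemma lin_rec_int_1 [simp]: "lin_rec_int \<alpha> \<beta> p q 1 = \<beta>"
  by (simp add: lin_rec_int_def)

text \<open>The guard \<open>q \<noteq> 0 \<or> k \<ge> 0\<close> is needed since the recurrence cannot be run backwards for \<open>q = 0\<close>.\<close>

lemma lin_rec_int_rec':
  assumes "q \<noteq> 0 \<or> k \<ge> 0"
  shows "lin_rec_int \<alpha> \<beta> p q (k + 2)
           = p * lin_rec_int \<alpha> \<beta> p q (k + 1) - q * lin_rec_int \<alpha> \<beta> p q k"
proof (cases "q = 0")
  case True
  then obtain n where "k = int n" using assms by (metis nonneg_int_cases)
  then show ?thesis by (simp add: lin_rec_int_def nat_add_distrib)
qed (rule lin_rec_int_rec)

lemma lin_rec_int_2 [simp]: "lin_rec_int \<alpha> \<beta> p q 2 = p * \<beta> - q * \<alpha>"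
  using lin_rec_int_rec'[of q 0 \<alpha> \<beta> p] by simp

text \<open>The guard leaves two cases: for \<open>q = 0\<close> an upward induction suffices, for
  \<open>q \<noteq> 0\<close> the induction runs from 0 in both directions.\<close>

lemma guarded_int_induct [consumes 1, case_names 0 up down]:
  assumes "q \<noteq> (0::'a::field) \<or> k \<ge> 0"
    and "P 0"
    and "\<And>k. k \<ge> 0 \<Longrightarrow> P k \<Longrightarrow> P (k + 1)"
    and "\<And>k. q \<noteq> 0 \<Longrightarrow> P (k + 1) \<Longrightarrow> P k"
  shows "P (k::int)"
proof (cases "q = 0")
  case True
  then have "0 \<le> k" using assms(1) by simp
  then show ?thesis by (induction rule: int_ge_induct) (use assms in auto)
next
  case False
  show ?thesis
  proof (induction k rule: int_induct[where k = 0])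
    case (step2 i)
    then show ?case using assms(4)[of "i - 1"] False by simp
  qed (use assms(2,3) in auto)
qed

text \<open>Both sides solve the same recurrence and agree at 0 and 1. An arbitrary \<open>f\<close>
  is allowed so that shifts and subsequences of solutions are covered.\<close>

lemma recurrence_solution:
  fixes f :: "int \<Rightarrow> 'a::field"
  assumes rec: "\<And>k. q \<noteq> 0 \<or> k \<ge> 0 \<Longrightarrow> f (k + 2) = p * f (k + 1) - q * f k"
    and k: "q \<noteq> 0 \<or> k \<ge> 0"
  shows "f k = lin_rec_int 1 0 p q k * f 0 + lin_rec_int 0 1 p q k * f 1"
proof -
  define h where "h k = lin_rec_int 1 0 p q k * f 0 + lin_rec_int 0 1 p q k * f 1" for k
  have h: "h (k + 2) = p * h (k + 1) - q * h k" if "q \<noteq> 0 \<or> k \<ge> 0" for k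
    using that by (simp add: h_def lin_rec_int_rec' algebra_simps)
  from k have "f k = h k \<and> f (k + 1) = h (k + 1)"
  proof (induction k rule: guarded_int_induct)
    case (up k)
    then show ?case using rec[of k] h[of k] by (simp add: add.assoc)
  next
    case (down k)
    \<comment> \<open>Downwards the recurrence fixes only \<open>q * f k\<close>, so
      \<open>q\<close> has to be cancelled.\<close>
    have "q * f k = p * f (k + 1) - f (k + 2)" "q * h k = p * h (k + 1) - h (k + 2)"
      using rec[of k] h[of k] down by simp_all
    then have "q * f k = q * h k" using down by (simp only: add.assoc one_add_one)
    then have "f k = h k" using down by (metis mult_left_cancel)
    then show ?case using down by simp
  qed (simp add: h_def)
  then show ?thesis by (simp add: h_def)
qed

text \<open>The shift of \<open>f\<close> by \<open>n\<close> solves the same recurrence, with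
  initial values \<open>f n\<close> and \<open>f (n + 1)\<close>.\<close>

lemma recurrence_add:
  fixes f :: "int \<Rightarrow> 'a::field"
  assumes rec: "\<And>k. q \<noteq> 0 \<or> k \<ge> 0 \<Longrightarrow> f (k + 2) = p * f (k + 1) - q * f k"
    and "q \<noteq> 0 \<or> m \<ge> 0 \<and> n \<ge> 0"
  shows "f (n + m) = lin_rec_int 1 0 p q m * f n + lin_rec_int 0 1 p q m * f (n + 1)"
proof -
  have "f (n + (k + 2)) = p * f (n + (k + 1)) - q * f (n + k)" if "q \<noteq> 0 \<or> k \<ge> 0" for k
    using rec[of "n + k"] assms(2) that by (auto simp: add.assoc)
  then show ?thesis
    using recurrence_solution[of q "\<lambda>k. f (n + k)" p m] assms(2) by auto
qed

lemma lin_rec_int_add: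
  assumes "q \<noteq> 0 \<or> m \<ge> 0 \<and> n \<ge> 0"
  shows "lin_rec_int \<alpha> \<beta> p q (n + m) = lin_rec_int 1 0 p q m * lin_rec_int \<alpha> \<beta> p q n
           + lin_rec_int 0 1 p q m * lin_rec_int \<alpha> \<beta> p q (n + 1)"
  using lin_rec_int_rec' assms by (rule recurrence_add)

text \<open>The addition law with \<open>n = 1\<close>, where \<open>T_1 = 0\<close>,
  \<open>T_2 = -q\<close>, \<open>U_1 = 1\<close>, \<open>U_2 = p\<close>.\<close>

lemma lin_rec_int_add1:
  assumes "q \<noteq> 0 \<or> k \<ge> 0"
  shows "lin_rec_int 1 0 p q (k + 1) = - q * lin_rec_int 0 1 p q k"
    and "lin_rec_int 0 1 p q (k + 1) = lin_rec_int 1 0 p q k + p * lin_rec_int 0 1 p q k"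
  using lin_rec_int_add[of q k 1 1 0 p] lin_rec_int_add[of q k 1 0 1 p] assms
  by (auto simp: add.commute)

section \<open>Trace and determinant of matrix powers; arithmetic progressions\<close>

lemma companion_trace:
  assumes "q \<noteq> 0 \<or> k \<ge> 0"
  shows "lin_rec_int 2 p p q k = lin_rec_int 1 0 p q k + lin_rec_int 0 1 p q (k + 1)"
  using lin_rec_int_add[of q k 0 2 p p] lin_rec_int_add1[of q k p] assms
  by (auto simp: algebra_simps)

text \<open>The determinant gains a factor \<open>q\<close>, the determinant of the companion
  matrix, with each step.\<close>

lemma companion_det:
  assumes "q \<noteq> 0 \<or> k \<ge> 0"
  shows "lin_rec_int 1 0 p q k * lin_rec_int 0 1 p q (k + 1)
           - lin_rec_int 0 1 p q k * lin_rec_int 1 0 p q (k + 1) = q powi k"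
proof -
  define d where "d k = lin_rec_int 1 0 p q k * lin_rec_int 0 1 p q (k + 1)
           - lin_rec_int 0 1 p q k * lin_rec_int 1 0 p q (k + 1)" for k
  have step: "d (k + 1) = q * d k" if "q \<noteq> 0 \<or> k \<ge> 0" for k
    unfolding d_def add.assoc one_add_one lin_rec_int_rec'[OF that] lin_rec_int_add1[OF that]
    by (simp add: algebra_simps)
  from assms have "d k = q powi k"
  proof (induction k rule: guarded_int_induct)
    case (up k)
    then show ?case using step[of k] by (simp add: power_int_add_1')
  next
    case (down k)
    then show ?case using step[of k] by (simp add: power_int_add_1')
  qed (simp add: d_def)
  then show ?thesis by (simp add: d_def)
qed

lemma recurrence_arith_progression:
  fixes f :: "int \<Rightarrow> 'a::field"
  assumes rec: "\<And>k. q \<noteq> 0 \<or> k \<ge> 0 \<Longrightarrow> f (k + 2) = p * f (k + 1) - q * f k"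
    and "q \<noteq> 0 \<or> r \<ge> 0 \<and> l \<ge> 0 \<and> k \<ge> 0"
  defines "v \<equiv> lin_rec_int 2 p p q r"
  shows "f (l + r * k) = lin_rec_int 1 0 v (q powi r) k * f l
                       + lin_rec_int 0 1 v (q powi r) k * f (l + r)"
proof -
  let ?T = "lin_rec_int 1 0 p q" and ?U = "lin_rec_int 0 1 p q"
  \<comment> \<open>Three instances of the addition law express both sides through
    \<open>f n\<close> and \<open>f (n + 1)\<close>; with trace and determinant expanded, this is
    Cayley-Hamilton for the \<open>r\<close>-th matrix power.\<close>
  have step: "f (n + r + r) = v * f (n + r) - q powi r * f n"
    if n: "q \<noteq> 0 \<or> n \<ge> 0" for n
  proof -
    have r: "q \<noteq> 0 \<or> r \<ge> 0" using assms(2) by auto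
    note add = recurrence_add[where f = f and p = p and q = q, OF rec]
    have 1: "f (n + r) = ?T r * f n + ?U r * f (n + 1)"
      using n r by (intro add) auto
    have 2: "f (n + r + r) = ?T r * f (n + r) + ?U r * f (n + r + 1)"
      using n r by (intro add) auto
    have 3: "f (n + r + 1) = ?T (r + 1) * f n + ?U (r + 1) * f (n + 1)"
      unfolding add.assoc using n r by (intro add) auto
    show ?thesis
      unfolding 2 3 1 v_def companion_trace[OF r] companion_det[OF r, of p, symmetric]
      by (simp add: algebra_simps)
  qed
  have "f (l + r * (k + 2)) = v * f (l + r * (k + 1)) - q powi r * f (l + r * k)"
    if "q powi r \<noteq> 0 \<or> k \<ge> 0" for k
  proof -
    \<comment> \<open>For \<open>q = 0\<close> the power \<open>q powi r\<close> is nonzero only if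
      \<open>r = 0\<close>; then the index is \<open>l\<close>, whatever the sign of
      \<open>k\<close>.\<close>
    have "q \<noteq> 0 \<or> l + r * k \<ge> 0"
      using that assms(2) by (cases "r = 0") (auto simp: power_int_def)
    then show ?thesis
      using step[of "l + r * k"] by (simp add: algebra_simps)
  qed
  moreover have "q powi r \<noteq> 0 \<or> k \<ge> 0" using assms(2) by auto
  ultimately show ?thesis
    using recurrence_solution[of "q powi r" "\<lambda>k. f (l + r * k)" v k] by simp
qed

section \<open>Integer powers of the companion matrix\<close>

lemma vector_2x2_eq_iff:
  "(A::'a::zero^2^2) = vector [vector [a, b], vector [c, d]]
     \<longleftrightarrow> A$1$1 = a \<and> A$1$2 = b \<and> A$2$1 = c \<and> A$2$2 = d"
  by (auto simp: vec_eq_iff forall_2)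

lemma matrix_inv_companion:
  assumes "q \<noteq> 0"
  shows "matrix_inv (companion p q) = vector [vector [p / q, - 1 / q], vector [1, 0]]"
    (is "_ = ?B")
proof -
  let ?A = "companion p q"
  have AB: "?A ** ?B = mat 1" and BA: "?B ** ?A = mat 1"
    using assms
    by (simp_all add: companion_def vec_eq_iff forall_2 matrix_matrix_mult_def sum_2 mat_def)
  \<comment> \<open>\<open>matrix_inv\<close> is a Hilbert choice: \<open>?B\<close> witnesses that
    an inverse exists, and multiplying by \<open>?B\<close> on the left then identifies the chosen
    one.\<close>
  then have "?A ** matrix_inv ?A = mat 1"
    unfolding matrix_inv_def by (metis (mono_tags, lifting) someI)
  then have "?B ** (?A ** matrix_inv ?A) = ?B" by simp
  then show ?thesis unfolding matrix_mul_assoc BA by simp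
qed

text \<open>Left multiplication by the companion matrix moves the second row up and appends the next
  values; its inverse runs the recurrence backwards.\<close>

lemma matrix_powi_companion:
  assumes "q \<noteq> 0 \<or> k \<ge> 0"
  shows "matrix_powi (companion p q) k
     = vector [vector [lin_rec_int 1 0 p q k, lin_rec_int 0 1 p q k],
               vector [lin_rec_int 1 0 p q (k + 1), lin_rec_int 0 1 p q (k + 1)]]"
proof -
  let ?F = "\<lambda>k. vector [vector [lin_rec_int 1 0 p q k, lin_rec_int 0 1 p q k],
               vector [lin_rec_int 1 0 p q (k + 1), lin_rec_int 0 1 p q (k + 1)]] :: 'a^2^2"
  have 0: "mat 1 = ?F 0"
    by (simp add: vector_2x2_eq_iff mat_def)
  have step: "companion p q ** ?F k = ?F (k + 1)" if "q \<noteq> 0 \<or> k \<ge> 0" for k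
    using lin_rec_int_rec'[OF that, of _ _ p]
    by (simp add: vector_2x2_eq_iff companion_def matrix_matrix_mult_def sum_2 add.assoc)
  have pos: "((**) (companion p q) ^^ n) (mat 1) = ?F (int n)" for n
    by (induction n) (simp_all add: 0 step add.commute[of 1])
  have neg: "((**) (matrix_inv (companion p q)) ^^ n) (mat 1) = ?F (- int n)" if "q \<noteq> 0" for n
  proof (induction n)
    case (Suc n)
    have "matrix_inv (companion p q) ** ?F (- int n) = ?F (- int n - 1)"
      using lin_rec_int_rec[OF that, of _ _ p "- int n - 1"] that
      by (simp add: vector_2x2_eq_iff matrix_inv_companion matrix_matrix_mult_def sum_2 field_simps)
    moreover have "- int (Suc n) = - int n - 1" by simp
    ultimately show ?case using Suc by (simp only: funpow.simps o_apply)
  qed (simp add: 0)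
  show ?thesis
  proof (cases "k \<ge> 0")
    case True
    then show ?thesis using pos[of "nat k"] by (simp add: matrix_powi_def)
  next
    case False
    then show ?thesis using neg[of "nat (- k)"] assms by (simp add: matrix_powi_def)
  qed
qed

section \<open>Evaluation of \<open>U\<close>, \<open>T\<close> and \<open>x\<close> along
  \<open>g\<close>\<close>

theorem theorem2p6:
  fixes p' q' :: "'a::idom" and p q :: "'a fract"
    and i j s t :: int and g :: "nat \<Rightarrow> int"
    and a1 a2 a3 a4 b1 b2 b3 b4 :: "'a fract"
    and U T V x :: "int \<Rightarrow> 'a fract"
    and Up Tp xp :: "int \<Rightarrow> int \<Rightarrow> 'a fract"
  defines "p \<equiv> to_fract p'" and "q \<equiv> to_fract q'"
  defines "U \<equiv> lin_rec_int 0 1 p q"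
    and "T \<equiv> lin_rec_int 1 0 p q"
    and "V \<equiv> lin_rec_int 2 p p q"
    and "x \<equiv> \<lambda>k. U k / U (k - 1)"
    and "g \<equiv> lin_rec i j s t"
  defines "Up \<equiv> \<lambda>r. lin_rec_int 0 1 (V r) (q powi r)"
    and "Tp \<equiv> \<lambda>r. lin_rec_int 1 0 (V r) (q powi r)"
  defines "xp \<equiv> \<lambda>r k. - q * Up r k / Tp r k"
  assumes "i \<ge> 2" and "j \<ge> 2"
    and "s < 0 \<or> - t < 0 \<Longrightarrow> q' \<noteq> 0"
    and "matrix_powi (companion p q) s = vector [vector [a1, a2], vector [a3, a4]]"
    and "matrix_powi (companion p q) (- t) = vector [vector [b1, b2], vector [b3, b4]]"
  shows "(\<forall>n\<ge>2.
      U (g n) = a2 * Up s (g (n - 1)) * Tp (- t) (g (n - 2))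
              + b2 * Tp s (g (n - 1)) * Up (- t) (g (n - 2))
              + (a1 * b2 + a2 * b4) * Up s (g (n - 1)) * Up (- t) (g (n - 2))
    \<and> T (g n) = Tp s (g (n - 1)) * Tp (- t) (g (n - 2))
              + a1 * Up s (g (n - 1)) * Tp (- t) (g (n - 2))
              + b1 * Tp s (g (n - 1)) * Up (- t) (g (n - 2))
              + (a1 * b1 + a2 * b3) * Up s (g (n - 1)) * Up (- t) (g (n - 2)))
  \<and> (\<forall>n\<ge>2. U (g n - 1) \<noteq> 0 \<longrightarrow> Tp s (g (n - 1)) \<noteq> 0 \<longrightarrow> Tp (- t) (g (n - 2)) \<noteq> 0 \<longrightarrow>
      (let y = xp s (g (n - 1)); z = xp (- t) (g (n - 2));
           D = q\<^sup>2 - q * a1 * y - q * b1 * z + (a1 * b1 + a2 * b3) * y * z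
       in D \<noteq> 0 \<and>
          x (g n) = (q\<^sup>2 * a2 * y + q\<^sup>2 * b2 * z - q * (a1 * b2 + a2 * b4) * y * z) / D))"
proof -
  have q0: "q = 0 \<longleftrightarrow> q' = 0" by (simp add: q_def)
  have s: "q \<noteq> 0 \<or> s \<ge> 0" and t: "q \<noteq> 0 \<or> - t \<ge> 0"
    using assms(13) q0 by linarith+
  have a: "a1 = T s" "a2 = U s"
    using assms(14) unfolding matrix_powi_companion[OF s] U_def T_def
    by (simp_all add: vector_2x2_eq_iff)
  have b: "b1 = T (- t)" "b2 = U (- t)" "b3 = T (- t + 1)" "b4 = U (- t + 1)"
    using assms(15) unfolding matrix_powi_companion[OF t] U_def T_def
    by (simp_all add: vector_2x2_eq_iff)
  have g_rec: "g (Suc (Suc n)) = s * g (Suc n) + (- t) * g n" for n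
    by (simp add: g_def)
  have g: "q \<noteq> 0 \<or> g n \<ge> 0" for n
  proof (cases "q = 0")
    case True
    with s t have "s \<ge> 0" "- t \<ge> 0" by auto
    have "g n \<ge> 0 \<and> g (Suc n) \<ge> 0"
    proof (induction n)
      case 0
      show ?case using assms(11,12) by (simp add: g_def)
    next
      case (Suc n)
      then show ?case
        unfolding g_rec using \<open>s \<ge> 0\<close> \<open>- t \<ge> 0\<close> by (metis add_nonneg_nonneg mult_nonneg_nonneg)
    qed
    then show ?thesis by simp
  qed simp
  have main: "U (g (Suc (Suc n))) = a2 * Up s (g (Suc n)) * Tp (- t) (g n)
              + b2 * Tp s (g (Suc n)) * Up (- t) (g n)
              + (a1 * b2 + a2 * b4) * Up s (g (Suc n)) * Up (- t) (g n)"
    "T (g (Suc (Suc n))) = Tp s (g (Suc n)) * Tp (- t) (g n)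
              + a1 * Up s (g (Suc n)) * Tp (- t) (g n)
              + b1 * Tp s (g (Suc n)) * Up (- t) (g n)
              + (a1 * b1 + a2 * b3) * Up s (g (Suc n)) * Up (- t) (g n)" for n
  proof -
    have m: "q \<noteq> 0 \<or> s * g (Suc n) \<ge> 0 \<and> - t * g n \<ge> 0"
      using s t g[of n] g[of "Suc n"] by (meson mult_nonneg_nonneg)
    have ap: "lin_rec_int \<alpha> \<beta> p q (l + r * k) = Tp r k * lin_rec_int \<alpha> \<beta> p q l
        + Up r k * lin_rec_int \<alpha> \<beta> p q (l + r)"
      if "q \<noteq> 0 \<or> r \<ge> 0 \<and> l \<ge> 0 \<and> k \<ge> 0" for \<alpha> \<beta> l r k
      unfolding Tp_def Up_def V_def
      by (rule recurrence_arith_progression[OF lin_rec_int_rec' that])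
    have S: "T (s * g (Suc n)) = Tp s (g (Suc n)) + Up s (g (Suc n)) * a1"
      "U (s * g (Suc n)) = Up s (g (Suc n)) * a2"
      using ap[of s 0 "g (Suc n)"] s g[of "Suc n"] unfolding a by (auto simp: T_def U_def)
    have t': "q \<noteq> 0 \<or> - t \<ge> 0 \<and> (0::int) \<le> 0 \<and> g n \<ge> 0"
      "q \<noteq> 0 \<or> - t \<ge> 0 \<and> (1::int) \<ge> 0 \<and> g n \<ge> 0"
      using t g[of n] by auto
    \<comment> \<open>Progressions starting at 0 give the first row of the matrix with entries
      \<open>b1\<close> to \<open>b4\<close>; those starting at 1 give the second row, which the
      addition law needs at the successor index.\<close>
    have R: "T (- t * g n) = Tp (- t) (g n) + Up (- t) (g n) * b1"
      "U (- t * g n) = Up (- t) (g n) * b2"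
      "T (- t * g n + 1) = Up (- t) (g n) * b3"
      "U (- t * g n + 1) = Tp (- t) (g n) + Up (- t) (g n) * b4"
      using ap[OF t'(1)] ap[OF t'(2)] unfolding b
      by (simp_all add: T_def U_def add.commute)
    have add: "lin_rec_int \<alpha> \<beta> p q (s * g (Suc n) + - t * g n)
        = T (s * g (Suc n)) * lin_rec_int \<alpha> \<beta> p q (- t * g n)
          + U (s * g (Suc n)) * lin_rec_int \<alpha> \<beta> p q (- t * g n + 1)" for \<alpha> \<beta>
      unfolding T_def U_def add.commute[of "s * g (Suc n)"]
      by (rule lin_rec_int_add[OF m])
    show "U (g (Suc (Suc n))) = a2 * Up s (g (Suc n)) * Tp (- t) (g n)
              + b2 * Tp s (g (Suc n)) * Up (- t) (g n)
              + (a1 * b2 + a2 * b4) * Up s (g (Suc n)) * Up (- t) (g n)"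
      using add[of 0 1] unfolding U_def[symmetric] g_rec S R by (simp add: algebra_simps)
    show "T (g (Suc (Suc n))) = Tp s (g (Suc n)) * Tp (- t) (g n)
              + a1 * Up s (g (Suc n)) * Tp (- t) (g n)
              + b1 * Tp s (g (Suc n)) * Up (- t) (g n)
              + (a1 * b1 + a2 * b3) * Up s (g (Suc n)) * Up (- t) (g n)"
      using add[of 1 0] unfolding T_def[symmetric] g_rec S R by (simp add: algebra_simps)
  qed
  have quot: "D \<noteq> 0 \<and> x (g (Suc (Suc n)))
        = (q\<^sup>2 * a2 * y + q\<^sup>2 * b2 * z - q * (a1 * b2 + a2 * b4) * y * z) / D"
    if U: "U (g (Suc (Suc n)) - 1) \<noteq> 0" and Ts: "Tp s (g (Suc n)) \<noteq> 0"
      and Tt: "Tp (- t) (g n) \<noteq> 0"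
      and y: "y = xp s (g (Suc n))" and z: "z = xp (- t) (g n)"
      and D: "D = q\<^sup>2 - q * a1 * y - q * b1 * z + (a1 * b1 + a2 * b3) * y * z" for n y z D
  proof -
    have "q \<noteq> 0"
    proof
      assume q: "q = 0"
      \<comment> \<open>If \<open>r * k \<noteq> 0\<close>, then \<open>q powi r = 0\<close>, and
        \<open>Tp r k\<close> vanishes because it has the factor \<open>q powi r\<close>.\<close>
      have vanish: "r * k = 0" if "Tp r k \<noteq> 0" "r \<ge> 0" "k \<ge> 0" for r k
      proof (rule ccontr)
        assume "r * k \<noteq> 0"
        with that q have "q powi r = 0" "k - 1 \<ge> 0" by (auto simp: power_int_def)
        then show False
          using that(1) lin_rec_int_add1(1)[of "q powi r" "k - 1" "V r"] by (simp add: Tp_def)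
      qed
      have "g (Suc (Suc n)) = 0"
        using vanish[OF Ts] vanish[OF Tt] s t g[of n] g[of "Suc n"] q by (auto simp: g_rec)
      \<comment> \<open>\<open>U\<^bsub>-1\<^esub>\<close> is \<open>0\<close> because of division by zero.\<close>
      then show False using U q by (simp add: U_def lin_rec_int_def)
    qed
    \<comment> \<open>Multiplication by \<open>P\<close> clears the denominators of \<open>y\<close>
      and \<open>z\<close>, turning \<open>D\<close> and the numerator into multiples of the
      formulas in \<open>main\<close>.\<close>
    define P where "P = Tp s (g (Suc n)) * Tp (- t) (g n)"
    have P: "P \<noteq> 0" using Ts Tt by (simp add: P_def)
    have TU: "T (g (Suc (Suc n))) = - q * U (g (Suc (Suc n)) - 1)"
      using lin_rec_int_add1(1)[of q "g (Suc (Suc n)) - 1" p] \<open>q \<noteq> 0\<close> by (simp add: T_def U_def)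
    have DT: "D * P = q\<^sup>2 * T (g (Suc (Suc n)))"
      unfolding D y z xp_def P_def main using Ts Tt
      by (simp add: field_simps power2_eq_square)
    have N: "(q\<^sup>2 * a2 * y + q\<^sup>2 * b2 * z - q * (a1 * b2 + a2 * b4) * y * z) * P
        = - (q ^ 3) * U (g (Suc (Suc n)))"
      unfolding y z xp_def P_def main using Ts Tt
      by (simp add: field_simps power2_eq_square power3_eq_cube)
    have D0: "D \<noteq> 0"
    proof
      assume "D = 0"
      then show False using DT TU U \<open>q \<noteq> 0\<close> by simp
    qed
    \<comment> \<open>The common factor \<open>P\<close> cancels; what remains is
      \<open>-q U / T\<close> at \<open>g (Suc (Suc n))\<close>, which \<open>TU\<close> turns into
      \<open>x\<close>.\<close>
    have "(q\<^sup>2 * a2 * y + q\<^sup>2 * b2 * z - q * (a1 * b2 + a2 * b4) * y * z) / D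
        = (- (q ^ 3) * U (g (Suc (Suc n)))) / (q\<^sup>2 * T (g (Suc (Suc n))))"
      unfolding N[symmetric] DT[symmetric] using P by simp
    also have "\<dots> = x (g (Suc (Suc n)))"
      unfolding TU x_def using U \<open>q \<noteq> 0\<close> by (simp add: power2_eq_square power3_eq_cube)
    finally show ?thesis using D0 by simp
  qed
  have shift: "(\<forall>n\<ge>2. Q n) \<longleftrightarrow> (\<forall>n. Q (Suc (Suc n)))" for Q :: "nat \<Rightarrow> bool"
    by (metis Suc_le_mono add_2_eq_Suc le_Suc_ex le_add1 numeral_2_eq_2 One_nat_def zero_le)
  show ?thesis
    unfolding shift Let_def using main quot[OF _ _ _ refl refl refl] by simp
qed

end
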